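(* Let $T_1\mathbb{S}_1^2$ be the unit tangent bundle of the de Sitter space $\mathbb{S}_1^2$, with its contact metric structure $(g_1,\phi,\xi,\eta)$. Then every non-geodesic Legendre curve and every non-geodesic slant curve $\tilde\gamma(t)=(\gamma(t),X(t))$ in $T_1\mathbb{S}_1^2$ (non-null, of any causal character, parametrized by arc length) is an $\tilde N$-Legendre curve.
   Context: $\mathbb{S}_1^2=\{x\in\mathbb{R}^3 : g(x,x)=1\}$ is the de Sitter space (Lorentzian sphere of radius 1) in Minkowski 3-space with $g=dx_1^2+dx_2^2-dx_3^2$, with the induced metric, also denoted $g$, of constant sectional curvature $1$. For a pseudo-Riemannian surface $(M,g)$ with Levi-Civita connection $\nabla$, $T_1M=\{(x,u)\in TM: g_x(u,u)=\pm1\}$. With $X^h,X^v$ the horizontal and vertical lifts, the tangent space of $T_1M$ at $(x,u)$ consists of the vectors $X^h+Y^v$ with $g(Y,u)=0$. The induced Sasaki metric $g_1^s$ satisfies, on such vectors, $g_1^s(X^h,Y^h)=g(X,Y)$, $g_1^s(X^h,Y^v)=0$, $g_1^s(Y^v,Z^v)=g(Y,Z)$ for $Y,Z\perp u$. The contact metric structure is normalized by $g_1=\tfrac14 g_1^s$, and the Reeb field at $(x,u)$ is $\xi=2u^h$ (so along $\tilde\gamma=(\gamma,X)$, $\xi=2X^h$). A non-null curve $\tilde\gamma$ in $(T_1M,g_1)$ parametrized by arc length has Frenet apparatus $(\tilde T,\tilde N,\tilde B,\tilde\kappa,\tilde\tau)$ with respect to the Levi-Civita connection of $g_1$: $\tilde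 T'=\tilde\kappa\tilde N$, $\tilde N'=-\varepsilon_1\varepsilon_2\tilde\kappa\tilde T+\tilde\tau\tilde B$, $\tilde B'=-\varepsilon_2\varepsilon_3\tilde\tau\tilde N$, where $\varepsilon_1,\varepsilon_2,\varepsilon_3=\pm1$ are the squared norms of $\tilde T,\tilde N,\tilde B$. The curve $\tilde\gamma$ is slant if $g_1(\tilde T,\xi)$ is a nonzero constant, Legendre if $g_1(\tilde T,\xi)=0$, $\tilde N$-Legendre if $g_1(\tilde N,\xi)=0$, and $\tilde N$-slant if $g_1(\tilde N,\xi)$ is a nonzero constant.
   Formalization: The curve is assumed to lie where the contact metric axioms hold, i.e. where g(X,X)=1; on the component g(X,X)=-1 of the unit tangent bundle g_1(ξ,ξ)=-1, the contact metric structure does not exist, and non-geodesic Legendre curves that are not Ñ-Legendre occur. *)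

theory Defs
  imports "HOL-Analysis.Analysis"
begin

section \<open>The de Sitter space and its unit tangent bundle\<close>

definition mink :: "real ^ 3 \<Rightarrow> real ^ 3 \<Rightarrow> real" where
  "mink x y = x $ 1 * y $ 1 + x $ 2 * y $ 2 - x $ 3 * y $ 3"

definition deSitter :: "(real ^ 3) set" where
  "deSitter = {x. mink x x = 1}"

definition deSitter_tangent :: "real ^ 3 \<Rightarrow> (real ^ 3) set" where
  "deSitter_tangent x = {v. mink x v = 0}"

text \<open>Points of the bundle, and vectors tangent to it, are pairs in \<open>real ^ 3 \<times> real ^ 3\<close>.\<close>

type_synonym pt = "(real ^ 3) \<times> (real ^ 3)"

definition unit_bundle :: "pt set" where
  "unit_bundle = {(x, u). x \<in> deSitter \<and> u \<in> deSitter_tangent x \<and> (mink u u = 1 \<or> mink u u = - 1)}"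

text \<open>The Levi-Civita connection of the de Sitter space is the flat derivative followed by the
  projection along the unit normal \<open>x\<close>. So the vector \<open>(a, b)\<close> at \<open>(x, u)\<close> has horizontal part
  \<open>a\<close> and vertical part \<open>deSitter_proj x b\<close> (the connection map), and it is horizontal iff \<open>b\<close>
  is normal; the multiple of \<open>x\<close> in \<open>hlift\<close> is the one for which \<open>mink x u = 0\<close> is preserved.\<close>

definition deSitter_proj :: "real ^ 3 \<Rightarrow> real ^ 3 \<Rightarrow> real ^ 3" where
  "deSitter_proj x v = v - mink v x *\<^sub>R x"

definition hlift :: "pt \<Rightarrow> real ^ 3 \<Rightarrow> pt" where
  "hlift p v = (v, - mink v (snd p) *\<^sub>R fst p)"

definition vlift :: "pt \<Rightarrow> real ^ 3 \<Rightarrow> pt" where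
  "vlift p v = (0, v)"

definition hpart :: "pt \<Rightarrow> pt \<Rightarrow> real ^ 3" where
  "hpart p V = fst V"

definition vpart :: "pt \<Rightarrow> pt \<Rightarrow> real ^ 3" where
  "vpart p V = deSitter_proj (fst p) (snd V)"

definition bundle_tangent :: "pt \<Rightarrow> pt set" where
  "bundle_tangent p = {hlift p X + vlift p Y | X Y.
     X \<in> deSitter_tangent (fst p) \<and> Y \<in> deSitter_tangent (fst p) \<and> mink Y (snd p) = 0}"

definition sasaki :: "pt \<Rightarrow> pt \<Rightarrow> pt \<Rightarrow> real" where
  "sasaki p V W = mink (hpart p V) (hpart p W) + mink (vpart p V) (vpart p W)"

definition g1 :: "pt \<Rightarrow> pt \<Rightarrow> pt \<Rightarrow> real" where
  "g1 p V W = sasaki p V W / 4"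


section \<open>The contact metric structure\<close>

definition reeb :: "pt \<Rightarrow> pt" where
  "reeb p = 2 *\<^sub>R hlift p (snd p)"

definition eta :: "pt \<Rightarrow> pt \<Rightarrow> real" where
  "eta p V = g1 p V (reeb p)"

text \<open>\<open>phi\<close> sends \<open>X\<^sup>h\<close> to the vertical lift of the component of \<open>X\<close> orthogonal to \<open>u\<close>,
  and \<open>Y\<^sup>v\<close> to \<open>- Y\<^sup>h\<close>.\<close>

definition phi :: "pt \<Rightarrow> pt \<Rightarrow> pt" where
  "phi p V = vlift p (hpart p V - (mink (hpart p V) (snd p) / mink (snd p) (snd p)) *\<^sub>R snd p)
             - hlift p (vpart p V)"

text \<open>Exterior derivative with the usual contact-geometric factor 1/2, computed in the flat
  coordinates of the ambient space.\<close>

definition d_eta :: "pt \<Rightarrow> pt \<Rightarrow> pt \<Rightarrow> real" where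
  "d_eta p V W = (frechet_derivative (\<lambda>q. eta q W) (at p) V
                  - frechet_derivative (\<lambda>q. eta q V) (at p) W) / 2"

text \<open>The axioms of a contact metric structure \<open>(\<phi>, \<xi>, \<eta>, g\<^sub>1)\<close> at a point; \<open>\<eta> = g\<^sub>1(\<cdot>, \<xi>)\<close> holds
  by definition. See \<open>contact_metric_at_iff\<close> below for the points where they hold.\<close>

definition contact_metric_at :: "pt \<Rightarrow> bool" where
  "contact_metric_at p \<longleftrightarrow>
     eta p (reeb p) = 1 \<and>
     (\<forall>V\<in>bundle_tangent p. phi p (phi p V) = - V + eta p V *\<^sub>R reeb p) \<and>
     (\<forall>V\<in>bundle_tangent p. \<forall>W\<in>bundle_tangent p. d_eta p V W = g1 p V (phi p W))"


section \<open>The Levi-Civita connection of \<open>g\<^sub>1\<close>\<close>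

text \<open>An affine connection on the bundle is written as the flat derivative of the ambient space
  plus a correction \<open>\<Gamma> p V W\<close>, bilinear in \<open>V\<close> and \<open>W\<close>. Only the values of \<open>\<Gamma> p\<close> on tangent vectors
  matter; every bilinear map on \<open>bundle_tangent p\<close> extends to the whole space.\<close>

definition cov_along :: "(pt \<Rightarrow> pt \<Rightarrow> pt \<Rightarrow> pt) \<Rightarrow> (real \<Rightarrow> pt) \<Rightarrow> (real \<Rightarrow> pt) \<Rightarrow> real \<Rightarrow> pt" where
  "cov_along \<Gamma> c V t =
     vector_derivative V (at t) + \<Gamma> (c t) (vector_derivative c (at t)) (V t)"

definition cov :: "(pt \<Rightarrow> pt \<Rightarrow> pt \<Rightarrow> pt) \<Rightarrow> (pt \<Rightarrow> pt) \<Rightarrow> (pt \<Rightarrow> pt) \<Rightarrow> pt \<Rightarrow> pt" where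
  "cov \<Gamma> X Y p = frechet_derivative Y (at p) (X p) + \<Gamma> p (X p) (Y p)"

definition lie_bracket :: "(pt \<Rightarrow> pt) \<Rightarrow> (pt \<Rightarrow> pt) \<Rightarrow> pt \<Rightarrow> pt" where
  "lie_bracket X Y p = frechet_derivative Y (at p) (X p) - frechet_derivative X (at p) (Y p)"

definition tangent_field :: "(pt \<Rightarrow> pt) \<Rightarrow> bool" where
  "tangent_field X \<longleftrightarrow> (\<forall>p\<in>unit_bundle. X differentiable (at p) \<and> X p \<in> bundle_tangent p)"

definition bundle_curve :: "real set \<Rightarrow> (real \<Rightarrow> pt) \<Rightarrow> bool" where
  "bundle_curve I c \<longleftrightarrow> (\<forall>t\<in>I. c t \<in> unit_bundle \<and> c differentiable (at t))"

definition field_along :: "real set \<Rightarrow> (real \<Rightarrow> pt) \<Rightarrow> (real \<Rightarrow> pt) \<Rightarrow> bool" where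
  "field_along I c V \<longleftrightarrow> (\<forall>t\<in>I. V t \<in> bundle_tangent (c t) \<and> V differentiable (at t))"

definition affine_connection :: "(pt \<Rightarrow> pt \<Rightarrow> pt \<Rightarrow> pt) \<Rightarrow> bool" where
  "affine_connection \<Gamma> \<longleftrightarrow>
     (\<forall>p\<in>unit_bundle. bilinear (\<Gamma> p)) \<and>
     (\<forall>I c V. open I \<and> bundle_curve I c \<and> field_along I c V \<longrightarrow>
        (\<forall>t\<in>I. cov_along \<Gamma> c V t \<in> bundle_tangent (c t)))"

definition torsion_free :: "(pt \<Rightarrow> pt \<Rightarrow> pt \<Rightarrow> pt) \<Rightarrow> bool" where
  "torsion_free \<Gamma> \<longleftrightarrow>
     (\<forall>X Y. tangent_field X \<and> tangent_field Y \<longrightarrow>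
        (\<forall>p\<in>unit_bundle. cov \<Gamma> X Y p - cov \<Gamma> Y X p = lie_bracket X Y p))"

definition metric_connection :: "(pt \<Rightarrow> pt \<Rightarrow> pt \<Rightarrow> pt) \<Rightarrow> bool" where
  "metric_connection \<Gamma> \<longleftrightarrow>
     (\<forall>I c V W. open I \<and> bundle_curve I c \<and> field_along I c V \<and> field_along I c W \<longrightarrow>
        (\<forall>t\<in>I. ((\<lambda>s. g1 (c s) (V s) (W s)) has_real_derivative
           g1 (c t) (cov_along \<Gamma> c V t) (W t) + g1 (c t) (V t) (cov_along \<Gamma> c W t)) (at t)))"

definition levi_civita :: "(pt \<Rightarrow> pt \<Rightarrow> pt \<Rightarrow> pt) \<Rightarrow> bool" where
  "levi_civita \<Gamma> \<longleftrightarrow> affine_connection \<Gamma> \<and> torsion_free \<Gamma> \<and> metric_connection \<Gamma>"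


section \<open>Curves in the unit tangent bundle\<close>

definition arc_length_curve :: "real set \<Rightarrow> (real \<Rightarrow> pt) \<Rightarrow> (real \<Rightarrow> pt) \<Rightarrow> real \<Rightarrow> bool" where
  "arc_length_curve I c T \<epsilon> \<longleftrightarrow>
     bundle_curve I c \<and> (\<epsilon> = 1 \<or> \<epsilon> = - 1) \<and>
     (\<forall>t\<in>I. T t = vector_derivative c (at t) \<and> g1 (c t) (T t) (T t) = \<epsilon>)"

text \<open>Required at every parameter: where \<open>cov_along \<Gamma> c T\<close> vanishes the curve does not determine
  \<open>N\<close>.\<close>

definition non_geodesic ::
    "(pt \<Rightarrow> pt \<Rightarrow> pt \<Rightarrow> pt) \<Rightarrow> real set \<Rightarrow> (real \<Rightarrow> pt) \<Rightarrow> (real \<Rightarrow> pt) \<Rightarrow> bool" where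
  "non_geodesic \<Gamma> I c T \<longleftrightarrow> (\<forall>t\<in>I. cov_along \<Gamma> c T t \<noteq> 0)"

definition frenet_apparatus ::
    "(pt \<Rightarrow> pt \<Rightarrow> pt \<Rightarrow> pt) \<Rightarrow> real set \<Rightarrow> (real \<Rightarrow> pt) \<Rightarrow>
     (real \<Rightarrow> pt) \<Rightarrow> (real \<Rightarrow> pt) \<Rightarrow> (real \<Rightarrow> pt) \<Rightarrow> (real \<Rightarrow> real) \<Rightarrow> (real \<Rightarrow> real) \<Rightarrow>
     real \<Rightarrow> real \<Rightarrow> real \<Rightarrow> bool" where
  "frenet_apparatus \<Gamma> I c T N B \<kappa> \<tau> \<epsilon>\<^sub>1 \<epsilon>\<^sub>2 \<epsilon>\<^sub>3 \<longleftrightarrow>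
     arc_length_curve I c T \<epsilon>\<^sub>1 \<and> (\<epsilon>\<^sub>2 = 1 \<or> \<epsilon>\<^sub>2 = - 1) \<and> (\<epsilon>\<^sub>3 = 1 \<or> \<epsilon>\<^sub>3 = - 1) \<and>
     field_along I c T \<and> field_along I c N \<and> field_along I c B \<and>
     (\<forall>t\<in>I.
        g1 (c t) (N t) (N t) = \<epsilon>\<^sub>2 \<and> g1 (c t) (B t) (B t) = \<epsilon>\<^sub>3 \<and>
        g1 (c t) (T t) (N t) = 0 \<and> g1 (c t) (T t) (B t) = 0 \<and> g1 (c t) (N t) (B t) = 0 \<and>
        cov_along \<Gamma> c T t = \<kappa> t *\<^sub>R N t \<and>
        cov_along \<Gamma> c N t = - (\<epsilon>\<^sub>1 * \<epsilon>\<^sub>2 * \<kappa> t) *\<^sub>R T t + \<tau> t *\<^sub>R B t \<and>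
        cov_along \<Gamma> c B t = - (\<epsilon>\<^sub>2 * \<epsilon>\<^sub>3 * \<tau> t) *\<^sub>R N t)"

definition legendre :: "real set \<Rightarrow> (real \<Rightarrow> pt) \<Rightarrow> (real \<Rightarrow> pt) \<Rightarrow> bool" where
  "legendre I c T \<longleftrightarrow> (\<forall>t\<in>I. g1 (c t) (T t) (reeb (c t)) = 0)"

definition slant :: "real set \<Rightarrow> (real \<Rightarrow> pt) \<Rightarrow> (real \<Rightarrow> pt) \<Rightarrow> bool" where
  "slant I c T \<longleftrightarrow> (\<exists>k. k \<noteq> 0 \<and> (\<forall>t\<in>I. g1 (c t) (T t) (reeb (c t)) = k))"

definition N_legendre :: "real set \<Rightarrow> (real \<Rightarrow> pt) \<Rightarrow> (real \<Rightarrow> pt) \<Rightarrow> bool" where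
  "N_legendre I c N \<longleftrightarrow> (\<forall>t\<in>I. g1 (c t) (N t) (reeb (c t)) = 0)"


section \<open>Sanity checks for the definitions\<close>

lemma mink_commute: "mink x y = mink y x"
  by (simp add: mink_def)

lemma bounded_bilinear_mink: "bounded_bilinear mink"
  unfolding bilinear_conv_bounded_bilinear[symmetric]
  by (auto simp: bilinear_def mink_def algebra_simps intro!: linearI)

lemma mink_linear:
  "mink (x + y) z = mink x z + mink y z" "mink z (x + y) = mink z x + mink z y"
  "mink (x - y) z = mink x z - mink y z" "mink z (x - y) = mink z x - mink z y"
  "mink (- x) z = - mink x z" "mink z (- x) = - mink z x"
  "mink (r *\<^sub>R x) z = r * mink x z" "mink z (r *\<^sub>R x) = r * mink z x"
  "mink 0 z = 0" "mink z 0 = 0"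
  by (simp_all add: mink_def algebra_simps)

lemma unit_bundle_iff:
  "(x, u) \<in> unit_bundle \<longleftrightarrow> mink x x = 1 \<and> mink x u = 0 \<and> (mink u u = 1 \<or> mink u u = - 1)"
  by (simp add: unit_bundle_def deSitter_def deSitter_tangent_def)

lemma bundle_tangent_iff:
  assumes "(x, u) \<in> unit_bundle"
  shows "(a, b) \<in> bundle_tangent (x, u) \<longleftrightarrow>
    mink x a = 0 \<and> mink a u + mink x b = 0 \<and> mink u b = 0"
proof
  assume "(a, b) \<in> bundle_tangent (x, u)"
  then show "mink x a = 0 \<and> mink a u + mink x b = 0 \<and> mink u b = 0"
    using assms
    by (auto simp: bundle_tangent_def hlift_def vlift_def deSitter_tangent_def unit_bundle_iff
        mink_linear mink_commute)
next
  assume *: "mink x a = 0 \<and> mink a u + mink x b = 0 \<and> mink u b = 0"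
  have "(a, b) = hlift (x, u) a + vlift (x, u) (b + mink a u *\<^sub>R x)"
    by (simp add: hlift_def vlift_def)
  moreover have "a \<in> deSitter_tangent x" "b + mink a u *\<^sub>R x \<in> deSitter_tangent x"
    "mink (b + mink a u *\<^sub>R x) u = 0"
    using * assms by (auto simp: deSitter_tangent_def unit_bundle_iff mink_linear mink_commute)
  ultimately show "(a, b) \<in> bundle_tangent (x, u)"
    unfolding bundle_tangent_def by auto
qed

lemma sasaki_lifts:
  assumes "p \<in> unit_bundle" "Y \<in> deSitter_tangent (fst p)" "Y' \<in> deSitter_tangent (fst p)"
  shows "sasaki p (hlift p X + vlift p Y) (hlift p X' + vlift p Y') = mink X X' + mink Y Y'"
  using assms
  by (cases p) (auto simp: sasaki_def hpart_def vpart_def hlift_def vlift_def deSitter_proj_def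
      deSitter_tangent_def unit_bundle_iff mink_linear mink_commute algebra_simps)

lemma eta_formula:
  "eta (x, u) (a, b) = (mink a u + mink u u * (mink x x - 1) * mink b x * (1 - mink x x)) / 2"
  by (simp add: eta_def g1_def sasaki_def hpart_def vpart_def reeb_def hlift_def deSitter_proj_def
      mink_linear mink_commute field_simps)


lemma d_eta_formula:
  assumes "(x, u) \<in> unit_bundle"
  shows "d_eta (x, u) (a, b) (a', b') = (mink b a' - mink b' a) / 4"
proof -
  have D: "((\<lambda>q. eta q (a', b')) has_derivative (\<lambda>V. mink a' (snd V) / 2)) (at (x, u))" for a' b'
  proof -
    have eq: "(\<lambda>q. eta q (a', b')) = (\<lambda>q. (mink a' (snd q) + mink (snd q) (snd q) *
      (mink (fst q) (fst q) - 1) * mink b' (fst q) * (1 - mink (fst q) (fst q))) / 2)"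
      by (auto simp: fun_eq_iff eta_formula mink_commute)
    show ?thesis
      unfolding eq
      by (rule has_derivative_eq_rhs)
        (auto intro!: derivative_eq_intros bounded_bilinear.FDERIV[OF bounded_bilinear_mink]
          simp: unit_bundle_iff[THEN iffD1, OF assms] mink_linear)
  qed
  show ?thesis
    unfolding d_eta_def frechet_derivative_at[OF D, symmetric]
    by (simp add: mink_commute)
qed

lemma phi_formula:
  "phi (x, u) (a, b) =
     (mink b x *\<^sub>R x - b,
      a - (mink a u / mink u u) *\<^sub>R u + mink (b - mink b x *\<^sub>R x) u *\<^sub>R x)"
  by (simp add: phi_def vlift_def hlift_def hpart_def vpart_def deSitter_proj_def)

text \<open>The contact metric axioms hold exactly on the component of the bundle where \<open>u\<close> is
  spacelike: \<open>g\<^sub>1(\<xi>, \<xi>) = mink u u\<close>, so on the other component \<open>\<xi>\<close> is not a unit spacelike field.\<close>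

lemma contact_metric_at_iff:
  assumes p: "(x, u) \<in> unit_bundle"
  shows "contact_metric_at (x, u) \<longleftrightarrow> mink u u = 1"
proof -
  note c = p[unfolded unit_bundle_iff]
  have reeb: "reeb (x, u) = (2 *\<^sub>R u, - (2 * mink u u) *\<^sub>R x)"
    by (simp add: reeb_def hlift_def)
  have 1: "eta (x, u) (reeb (x, u)) = mink u u"
    using c by (simp add: reeb eta_formula mink_linear)
  have 2: "phi (x, u) (phi (x, u) V) = - V + eta (x, u) V *\<^sub>R reeb (x, u)"
    if "V \<in> bundle_tangent (x, u)" and u: "mink u u = 1" for V
  proof (cases V)
    case (Pair a b)
    have t': "mink u x = 0" "mink a x = 0" "mink x b = - mink a u" "mink u b = 0"
      using that Pair bundle_tangent_iff[OF p, of a b] c by (auto simp: mink_commute)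
    have t: "mink x a = 0" "mink b x = - mink a u" "mink b u = 0"
      using that Pair bundle_tangent_iff[OF p, of a b] by (auto simp: mink_commute)
    show ?thesis
      using t c u
      by (simp add: Pair phi_formula eta_formula reeb mink_linear t' algebra_simps)
  qed
  have 3: "d_eta (x, u) V W = g1 (x, u) V (phi (x, u) W)"
    if "V \<in> bundle_tangent (x, u)" "W \<in> bundle_tangent (x, u)" and u: "mink u u = 1" for V W
  proof (cases V; cases W)
    fix a b a' b' assume VW: "V = (a, b)" "W = (a', b')"
    have t': "mink u x = 0" "mink a x = 0" "mink x b = - mink a u" "mink u b = 0"
      "mink a' x = 0" "mink x b' = - mink a' u" "mink u b' = 0" "mink b' a = mink a b'"
      using that VW bundle_tangent_iff[OF p, of a b] bundle_tangent_iff[OF p, of a' b'] c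
      by (auto simp: mink_commute)
    have t: "mink x a = 0" "mink b x = - mink a u" "mink b u = 0"
      "mink x a' = 0" "mink b' x = - mink a' u" "mink b' u = 0"
      using that VW bundle_tangent_iff[OF p, of a b] bundle_tangent_iff[OF p, of a' b']
      by (auto simp: mink_commute)
    show ?thesis
      using t c u
      by (simp add: VW phi_formula d_eta_formula[OF p] g1_def sasaki_def hpart_def vpart_def
          deSitter_proj_def mink_linear t' algebra_simps)
  qed
  show ?thesis
    unfolding contact_metric_at_def using 1 2 3 by auto
qed


text \<open>A connection satisfying \<open>levi_civita\<close> exists. The coefficients are those of the Sasaki metric,
  \<open>\<nabla>\<^bsub>X\<^sup>h\<^esub> Y\<^sup>h = (\<nabla>\<^sub>X Y)\<^sup>h - (R(X, Y) u)\<^sup>v / 2\<close> etc., with \<open>R(X, Y) Z = g(Y, Z) X - g(X, Z) Y\<close>, and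
  a last term from restricting to \<open>mink u u\<close> constant.\<close>

definition lc_coeff :: "pt \<Rightarrow> pt \<Rightarrow> pt \<Rightarrow> pt" where
  "lc_coeff p V W =
    (let x = fst p; u = snd p; a = hpart p V; q = vpart p V; c = hpart p W; z = vpart p W;
         e = mink u u in
      (mink c a *\<^sub>R x + (1/2) *\<^sub>R (mink z a *\<^sub>R u - mink u a *\<^sub>R z)
         + (1/2) *\<^sub>R (mink q c *\<^sub>R u - mink u c *\<^sub>R q),
       (1/2) *\<^sub>R (mink c u *\<^sub>R a + mink a u *\<^sub>R c) + (e * mink z q) *\<^sub>R u
         + ((1 - e / 2) * (mink z a + mink q c)) *\<^sub>R x))"

lemma bilinear_lc_coeff: "bilinear (lc_coeff p)"
  by (auto simp: bilinear_def lc_coeff_def Let_def hpart_def vpart_def deSitter_proj_def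
      mink_linear algebra_simps add_divide_distrib diff_divide_distrib intro!: linearI)

lemma lc_coeff_commute: "lc_coeff p V W = lc_coeff p W V"
  by (simp add: lc_coeff_def Let_def mink_commute algebra_simps)

lemma has_vector_derivative_fst_snd:
  assumes "(c has_vector_derivative c') (at t)"
  shows "((\<lambda>s. fst (c s)) has_vector_derivative fst c') (at t)"
    and "((\<lambda>s. snd (c s)) has_vector_derivative snd c') (at t)"
  using assms bounded_linear.has_vector_derivative[OF bounded_linear_fst]
    bounded_linear.has_vector_derivative[OF bounded_linear_snd] by blast+

lemma mink_derivative:
  assumes "(f has_vector_derivative f') (at t)" "(h has_vector_derivative h') (at t)"
  shows "((\<lambda>s. mink (f s) (h s)) has_real_derivative mink (f t) h' + mink f' (h t)) (at t)"
  using bounded_bilinear.has_vector_derivative[OF bounded_bilinear_mink assms]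
  by (simp add: has_real_derivative_iff_has_vector_derivative)

lemma derivative_of_constraint:
  fixes f :: "real \<Rightarrow> real"
  assumes "(f has_real_derivative D) (at t)" "open I" "t \<in> I" "\<And>s. s \<in> I \<Longrightarrow> f s = k"
  shows "D = 0"
proof -
  have "((\<lambda>s. k) has_real_derivative D) (at t)"
    by (rule has_field_derivative_transform_within_open[OF assms(1-3)]) (simp add: assms(4))
  from DERIV_unique[OF this DERIV_const] show ?thesis .
qed

lemma curve_constraints:
  assumes I: "open I" "t \<in> I" and c: "bundle_curve I c"
    and xu: "c t = (x, u)" and c': "vector_derivative c (at t) = (a, b)"
  shows "mink x x = 1" "mink x u = 0" "mink u u = 1 \<or> mink u u = - 1"
    "mink x a = 0" "mink x b = - mink u a" "mink u b = 0"
proof -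
  have mem: "c s \<in> unit_bundle" if "s \<in> I" for s
    using c that by (auto simp: bundle_curve_def)
  have D: "(c has_vector_derivative (a, b)) (at t)"
    using c I c' by (metis bundle_curve_def vector_derivative_works)
  note D' = has_vector_derivative_fst_snd[OF D, simplified]
  have 1: "mink (fst (c s)) (fst (c s)) = 1" "mink (fst (c s)) (snd (c s)) = 0"
    "mink (snd (c s)) (snd (c s)) = 1 \<or> mink (snd (c s)) (snd (c s)) = - 1" if "s \<in> I" for s
    using mem[OF that] unit_bundle_iff[of "fst (c s)" "snd (c s)"] by auto
  show "mink x x = 1" "mink x u = 0" "mink u u = 1 \<or> mink u u = - 1"
    using 1[OF I(2)] xu by auto
  have "mink x a + mink a x = 0"
    using derivative_of_constraint[OF mink_derivative[OF D'(1) D'(1)] I 1(1)] xu by simp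
  then show "mink x a = 0" by (simp add: mink_commute)
  have "mink x b + mink a u = 0"
    using derivative_of_constraint[OF mink_derivative[OF D'(1) D'(2)] I 1(2)] xu by simp
  then show "mink x b = - mink u a" by (simp add: mink_commute)
  have "((\<lambda>s. (mink (snd (c s)) (snd (c s)))\<^sup>2) has_real_derivative
      2 * mink u u * (mink u b + mink b u)) (at t)"
    using DERIV_power[OF mink_derivative[OF D'(2) D'(2)], of 2] xu by (simp add: algebra_simps)
  then have "2 * mink u u * (mink u b + mink b u) = 0"
    by (rule derivative_of_constraint[OF _ I, where k = 1]) (simp add: power2_eq_1_iff 1(3))
  then show "mink u b = 0"
    using \<open>mink u u = 1 \<or> mink u u = - 1\<close> by (auto simp: mink_commute)
qed

lemma field_constraints:
  assumes I: "open I" "t \<in> I" and c: "bundle_curve I c" and V: "field_along I c V"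
    and xu: "c t = (x, u)" and c': "vector_derivative c (at t) = (a, b)"
    and yd: "V t = (y, d)" and V': "vector_derivative V (at t) = (y', d')"
  shows "mink x y = 0" "mink x d = - mink u y" "mink u d = 0"
    "mink x y' = - mink a y" "mink u d' = - mink b d"
    "mink x d' = - mink a d - mink b y - mink u y'"
proof -
  have mem: "c s \<in> unit_bundle" "V s \<in> bundle_tangent (c s)" if "s \<in> I" for s
    using c V that by (auto simp: bundle_curve_def field_along_def)
  have D: "(c has_vector_derivative (a, b)) (at t)"
    using c I c' by (metis bundle_curve_def vector_derivative_works)
  have E: "(V has_vector_derivative (y', d')) (at t)"
    using V I V' by (metis field_along_def vector_derivative_works)
  note D' = has_vector_derivative_fst_snd[OF D, simplified]
  note E' = has_vector_derivative_fst_snd[OF E, simplified]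
  have 1: "mink (fst (c s)) (fst (V s)) = 0"
    "mink (snd (c s)) (fst (V s)) + mink (fst (c s)) (snd (V s)) = 0"
    "mink (snd (c s)) (snd (V s)) = 0" if "s \<in> I" for s
    using mem[OF that] bundle_tangent_iff[of "fst (c s)" "snd (c s)" "fst (V s)" "snd (V s)"]
    by (auto simp: mink_commute)
  show "mink x y = 0" "mink x d = - mink u y" "mink u d = 0"
    using 1[OF I(2)] xu yd by auto
  show "mink x y' = - mink a y"
    using derivative_of_constraint[OF mink_derivative[OF D'(1) E'(1)] I 1(1)] xu yd by simp
  show "mink u d' = - mink b d"
    using derivative_of_constraint[OF mink_derivative[OF D'(2) E'(2)] I 1(3)] xu yd by simp
  have "mink u y' + mink b y + (mink x d' + mink a d) = 0"
    using derivative_of_constraint[OF DERIV_add[OF mink_derivative[OF D'(2) E'(1)]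
        mink_derivative[OF D'(1) E'(2)]] I 1(2)] xu yd by simp
  then show "mink x d' = - mink a d - mink b y - mink u y'"
    by simp
qed

lemma affine_connection_lc_coeff: "affine_connection lc_coeff"
  unfolding affine_connection_def
proof (intro conjI ballI allI impI bilinear_lc_coeff)
  fix I c V t
  assume *: "open I \<and> bundle_curve I c \<and> field_along I c V" "t \<in> I"
  obtain x u a b y d y' d' where eqs: "c t = (x, u)" "vector_derivative c (at t) = (a, b)"
    "V t = (y, d)" "vector_derivative V (at t) = (y', d')"
    by (metis surj_pair)
  have p: "(x, u) \<in> unit_bundle"
    using * eqs by (metis bundle_curve_def)
  note cc = curve_constraints[OF _ *(2) _ eqs(1,2)]
  note fc = field_constraints[OF _ *(2) _ _ eqs]
  have s: "mink x x = 1" "mink x u = 0" "mink u u = 1 \<or> mink u u = - 1"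
    "mink x a = 0" "mink x b = - mink u a" "mink u b = 0"
    "mink x y = 0" "mink x d = - mink u y" "mink u d = 0"
    "mink x y' = - mink a y" "mink u d' = - mink b d"
    "mink x d' = - mink a d - mink b y - mink u y'"
    using cc fc * by auto
  have s': "mink u x = 0" "mink a x = 0" "mink b x = - mink u a" "mink b u = 0" "mink y x = 0"
    "mink d x = - mink u y" "mink d u = 0" "mink a u = mink u a" "mink y u = mink u y"
    "mink y' x = - mink a y" "mink d' u = - mink b d" "mink y' u = mink u y'"
    "mink y a = mink a y" "mink d b = mink b d" "mink y b = mink b y" "mink d a = mink a d"
    "mink d' x = - mink a d - mink b y - mink u y'"
    using s by (simp_all add: mink_commute)
  show "cov_along lc_coeff c V t \<in> bundle_tangent (c t)"
    unfolding cov_along_def eqs lc_coeff_def Let_def hpart_def vpart_def deSitter_proj_def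
      fst_conv snd_conv add_Pair bundle_tangent_iff[OF p] mink_linear s(1,2,4-) s'
    using s(3) by (auto simp: field_simps)
qed

lemma torsion_free_lc_coeff: "torsion_free lc_coeff"
  by (simp add: torsion_free_def cov_def lie_bracket_def lc_coeff_commute)

lemma g1_formula:
  assumes "mink x x = 1"
  shows "g1 (x, u) (a, b) (a', b') = (mink a a' + mink b b' - mink x b * mink x b') / 4"
  using assms
  by (simp add: g1_def sasaki_def hpart_def vpart_def deSitter_proj_def mink_linear mink_commute)

lemma metric_connection_lc_coeff: "metric_connection lc_coeff"
  unfolding metric_connection_def
proof (intro ballI allI impI)
  fix I c V W t
  assume *: "open I \<and> bundle_curve I c \<and> field_along I c V \<and> field_along I c W" "t \<in> I"
  obtain x u a b y d y' d' z f z' f' where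
    eqs: "c t = (x, u)" "vector_derivative c (at t) = (a, b)"
    "V t = (y, d)" "vector_derivative V (at t) = (y', d')" and
    eqs': "W t = (z, f)" "vector_derivative W (at t) = (z', f')"
    by (metis surj_pair)
  note cc = curve_constraints[OF _ *(2) _ eqs(1,2)]
  note fc = field_constraints[OF _ *(2) _ _ eqs]
  note fc' = field_constraints[OF _ *(2) _ _ eqs(1,2) eqs']
  have D: "(c has_vector_derivative (a, b)) (at t)" "(V has_vector_derivative (y', d')) (at t)"
    "(W has_vector_derivative (z', f')) (at t)"
    using * eqs eqs' by (metis bundle_curve_def field_along_def vector_derivative_works)+
  note D1 = has_vector_derivative_fst_snd[OF D(1), simplified]
  note D2 = has_vector_derivative_fst_snd[OF D(2), simplified]
  note D3 = has_vector_derivative_fst_snd[OF D(3), simplified]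
  have g1: "g1 (c s) (V s) (W s) = (mink (fst (V s)) (fst (W s)) + mink (snd (V s)) (snd (W s))
      - mink (fst (c s)) (snd (V s)) * mink (fst (c s)) (snd (W s))) / 4" if "s \<in> I" for s
    using * that unit_bundle_iff[of "fst (c s)" "snd (c s)"]
      g1_formula[of "fst (c s)" "snd (c s)" "fst (V s)" "snd (V s)" "fst (W s)" "snd (W s)"]
    by (auto simp: bundle_curve_def)
  have der: "((\<lambda>s. (mink (fst (V s)) (fst (W s)) + mink (snd (V s)) (snd (W s))
      - mink (fst (c s)) (snd (V s)) * mink (fst (c s)) (snd (W s))) / 4) has_real_derivative
      (mink y z' + mink y' z + (mink d f' + mink d' f)
       - ((mink x d' + mink a d) * mink x f + (mink x f' + mink a f) * mink x d)) / 4) (at t)"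
    using DERIV_cdivide[OF DERIV_diff[OF DERIV_add[OF mink_derivative[OF D2(1) D3(1)]
      mink_derivative[OF D2(2) D3(2)]] DERIV_mult[OF mink_derivative[OF D1(1) D2(2)]
      mink_derivative[OF D1(1) D3(2)]]], of 4] eqs eqs'
    by (simp add: algebra_simps)
  have s: "mink x x = 1" "mink x u = 0" "mink u u = 1 \<or> mink u u = - 1"
    "mink x a = 0" "mink x b = - mink u a" "mink u b = 0"
    "mink x y = 0" "mink x d = - mink u y" "mink u d = 0"
    "mink x y' = - mink a y" "mink u d' = - mink b d"
    "mink x d' = - mink a d - mink b y - mink u y'"
    "mink x z = 0" "mink x f = - mink u z" "mink u f = 0"
    "mink x z' = - mink a z" "mink u f' = - mink b f"
    "mink x f' = - mink a f - mink b z - mink u z'"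
    using cc fc fc' * by auto
  have s': "mink u x = 0" "mink a x = 0" "mink b x = - mink u a" "mink b u = 0" "mink y x = 0"
    "mink d x = - mink u y" "mink d u = 0" "mink a u = mink u a" "mink y u = mink u y"
    "mink y' x = - mink a y" "mink d' u = - mink b d" "mink y' u = mink u y'"
    "mink y a = mink a y" "mink d b = mink b d" "mink y b = mink b y" "mink d a = mink a d"
    "mink d' x = - mink a d - mink b y - mink u y'"
    "mink z x = 0" "mink f x = - mink u z" "mink f u = 0" "mink z u = mink u z"
    "mink z' x = - mink a z" "mink f' u = - mink b f" "mink z' u = mink u z'"
    "mink z a = mink a z" "mink f b = mink b f" "mink z b = mink b z" "mink f a = mink a f"
    "mink f' x = - mink a f - mink b z - mink u z'"
    "mink z y = mink y z" "mink f d = mink d f" "mink z d = mink d z" "mink f y = mink y f"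
    using s by (simp_all add: mink_commute)
  have "(mink y z' + mink y' z + (mink d f' + mink d' f)
       - ((mink x d' + mink a d) * mink x f + (mink x f' + mink a f) * mink x d)) / 4
     = g1 (c t) (cov_along lc_coeff c V t) (W t) + g1 (c t) (V t) (cov_along lc_coeff c W t)"
    unfolding cov_along_def eqs eqs' lc_coeff_def Let_def hpart_def vpart_def deSitter_proj_def
      fst_conv snd_conv add_Pair g1_formula[OF s(1)] mink_linear s(1,2,4-) s'
    using s(3) by (auto simp: field_simps)
  note der = der[unfolded this]
  show "((\<lambda>s. g1 (c s) (V s) (W s)) has_real_derivative
      g1 (c t) (cov_along lc_coeff c V t) (W t) + g1 (c t) (V t) (cov_along lc_coeff c W t)) (at t)"
    by (rule has_field_derivative_transform_within_open[OF der _ *(2)]) (use * g1 in auto)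
qed

lemma levi_civita_lc_coeff: "levi_civita lc_coeff"
  by (simp add: levi_civita_def affine_connection_lc_coeff torsion_free_lc_coeff
      metric_connection_lc_coeff)

end

theory Submission
  imports Defs
begin

text \<open>Since the de Sitter space has curvature \<open>1\<close>, the Reeb field is a Killing field: its flow, the
  rotation of the pair \<open>(x, u)\<close> in its plane, commutes with the action of the isometry group
  \<open>SO(2, 1)\<close>, and the infinitesimal generators \<open>(A x, A u)\<close> of that action span every tangent space
  and have constant length along the flow. Hence \<open>g\<^sub>1(\<nabla>\<^sub>T \<xi>, T) = 0\<close>, and differentiating the
  constant \<open>g\<^sub>1(T, \<xi>)\<close> gives \<open>\<kappa> g\<^sub>1(N, \<xi>) = 0\<close>.\<close>

section \<open>The Lie algebra of \<open>SO(2, 1)\<close> and its action on the bundle\<close>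

definition mink_skew :: "(real ^ 3 \<Rightarrow> real ^ 3) \<Rightarrow> bool" where
  "mink_skew A \<longleftrightarrow> bounded_linear A \<and> (\<forall>y z. mink (A y) z = - mink y (A z))"

definition infinitesimal_action :: "(real ^ 3 \<Rightarrow> real ^ 3) \<Rightarrow> pt \<Rightarrow> pt" where
  "infinitesimal_action A q = (A (fst q), A (snd q))"

text \<open>The factor 2 in the angle is the factor 2 in \<open>reeb\<close>. The curve is an
  integral curve of \<open>reeb\<close> when \<open>mink u u = 1\<close>; for timelike
  \<open>u\<close> hyperbolic functions would replace \<open>cos\<close> and
  \<open>sin\<close>.\<close>

definition reeb_flow :: "pt \<Rightarrow> real \<Rightarrow> pt" where
  "reeb_flow p s = (cos (2 * s) *\<^sub>R fst p + sin (2 * s) *\<^sub>R snd p,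
                    cos (2 * s) *\<^sub>R snd p - sin (2 * s) *\<^sub>R fst p)"

lemma bounded_linear_mink_right: "bounded_linear (mink y)"
  by (rule bounded_bilinear.bounded_linear_right[OF bounded_bilinear_mink])

lemma infinitesimal_action_onto:
  assumes p: "(x, u) \<in> unit_bundle" and u: "mink u u = 1"
    and v: "v \<in> bundle_tangent (x, u)"
  obtains A where "mink_skew A" "infinitesimal_action A (x, u) = v"
proof -
  obtain a b where v_eq: "v = (a, b)" by fastforce
  have xu: "mink x x = 1" "mink x u = 0" "mink u x = 0"
    using p by (auto simp: unit_bundle_iff mink_commute)
  have t: "mink a x = 0" "mink x b = - mink a u" "mink b u = 0"
    "mink b x = - mink a u"
    using v bundle_tangent_iff[OF p, of a b] by (auto simp: v_eq mink_commute)
  \<comment> \<open>A sum of three elementary skew maps. The first sends \<open>x\<close> to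
    \<open>a\<close>, the second sends \<open>u\<close> to \<open>b\<close>; the third cancels the
    excess \<open>- mink a u\<close> times \<open>x\<close> of the first at \<open>u\<close> and
    \<open>mink a u\<close> times \<open>u\<close> of the second at \<open>x\<close>.\<close>
  define A where "A w = mink x w *\<^sub>R a - mink a w *\<^sub>R x + (mink u w *\<^sub>R b - mink b w *\<^sub>R u)
    + mink a u *\<^sub>R (mink u w *\<^sub>R x - mink x w *\<^sub>R u)" for w
  have "bounded_linear A"
    unfolding A_def
    by (intro bounded_linear_add bounded_linear_sub bounded_linear_mink_right
        bounded_linear_const_scaleR bounded_linear_scaleR_const)
  moreover have "mink (A y) z = - mink y (A z)" for y z
    by (simp add: A_def mink_linear mink_commute[of y] algebra_simps)
  ultimately have "mink_skew A"
    by (simp add: mink_skew_def)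
  moreover have "infinitesimal_action A (x, u) = v"
    using xu u t by (simp add: infinitesimal_action_def A_def v_eq)
  ultimately show ?thesis by (rule that)
qed

lemma infinitesimal_action_has_derivative:
  assumes "mink_skew A"
  shows "(infinitesimal_action A has_derivative infinitesimal_action A) (at q)"
proof -
  have A: "bounded_linear A"
    using assms by (simp add: mink_skew_def)
  have "bounded_linear (infinitesimal_action A)"
    unfolding infinitesimal_action_def
    by (intro bounded_linear_Pair bounded_linear_compose[OF A]
        bounded_linear_fst bounded_linear_snd)
  then show ?thesis
    by (rule bounded_linear_imp_has_derivative)
qed

text \<open>The linearized equations of the bundle at \<open>(x, u)\<close> are instances of
  skewness for the pairs from \<open>x\<close> and \<open>u\<close>.\<close>

lemma tangent_field_infinitesimal_action:
  assumes "mink_skew A"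
  shows "tangent_field (infinitesimal_action A)"
proof -
  have skew: "mink (A y) z = - mink y (A z)" for y z
    using assms by (simp add: mink_skew_def)
  have null: "mink y (A y) = 0" for y
    using skew[of y y] mink_commute[of y "A y"] by simp
  show ?thesis
    unfolding tangent_field_def
    using infinitesimal_action_has_derivative[OF assms]
    by (auto simp: differentiable_def infinitesimal_action_def bundle_tangent_iff null skew)
qed

section \<open>The Reeb field, and fields restricted to curves\<close>

lemma reeb_formula: "reeb (x, u) = (2 *\<^sub>R u, - (2 * mink u u) *\<^sub>R x)"
  by (simp add: reeb_def hlift_def)

text \<open>The last term appears because \<open>mink u u\<close>, locally constant on the bundle,
  varies in the ambient space.\<close>

lemma reeb_has_derivative:
  "(reeb has_derivative (\<lambda>V. (2 *\<^sub>R snd V,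
     - (2 * mink u u) *\<^sub>R fst V - (4 * mink u (snd V)) *\<^sub>R x))) (at (x, u))"
proof -
  have eq: "reeb = (\<lambda>q. (2 *\<^sub>R snd q, (- 2 * mink (snd q) (snd q)) *\<^sub>R fst q))"
    by (auto simp: fun_eq_iff reeb_formula)
  note fst = has_derivative_fst[OF has_derivative_ident, of "at (x, u)"]
    and snd = has_derivative_snd[OF has_derivative_ident, of "at (x, u)"]
  note sq = bounded_bilinear.FDERIV[OF bounded_bilinear_mink snd snd]
  have comm: "mink (snd v) u = mink u (snd v)" for v :: pt
    by (rule mink_commute)
  show ?thesis
    unfolding eq
    by (rule has_derivative_eq_rhs,
        rule has_derivative_Pair[OF has_derivative_scaleR_right[OF snd, of 2]
          has_derivative_scaleR[OF has_derivative_mult_right[OF sq, of "- 2"] fst]])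
      (simp add: fun_eq_iff comm)
qed

lemma tangent_field_reeb: "tangent_field reeb"
  unfolding tangent_field_def
proof
  fix p
  assume p: "p \<in> unit_bundle"
  obtain x u where xu: "p = (x, u)" by fastforce
  have "reeb differentiable (at p)"
    unfolding xu differentiable_def using reeb_has_derivative by blast
  moreover have "reeb p \<in> bundle_tangent p"
    using p unfolding xu reeb_formula bundle_tangent_iff[OF p[unfolded xu]] unit_bundle_iff
    by (simp add: mink_linear mink_commute[of u x])
  ultimately show "reeb differentiable (at p) \<and> reeb p \<in> bundle_tangent p" ..
qed

text \<open>Infinitesimal form of the equivariance of \<open>reeb\<close> under linear isometries,
  valid on the whole ambient space: the term from differentiating \<open>mink u u\<close> drops out
  since \<open>mink u (A u) = 0\<close>.\<close>

lemma lie_bracket_infinitesimal_action_reeb: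
  assumes A: "mink_skew A"
  shows "lie_bracket (infinitesimal_action A) reeb (x, u) = 0"
proof -
  have "mink u (A u) = 0"
    using A mink_commute[of u "A u"] unfolding mink_skew_def by (metis neg_equal_zero)
  moreover have "A (r *\<^sub>R y) = r *\<^sub>R A y" for r y
    using A by (simp add: mink_skew_def linear_simps(5))
  moreover have "A (- y) = - A y" for y
    using A by (simp add: mink_skew_def bounded_linear.linear linear_neg)
  ultimately show ?thesis
    unfolding lie_bracket_def frechet_derivative_at[OF reeb_has_derivative, symmetric]
      frechet_derivative_at[OF infinitesimal_action_has_derivative[OF A], symmetric]
    by (simp add: infinitesimal_action_def reeb_formula zero_prod_def)
qed

text \<open>Links metric compatibility, phrased along curves, with torsion-freeness, phrased for
  fields. The field \<open>X\<close> has to match the velocity at the single point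
  \<open>c t\<close> only.\<close>

lemma cov_along_compose:
  assumes c: "c differentiable (at t)" and Y: "Y differentiable (at (c t))"
    and X: "X (c t) = vector_derivative c (at t)"
  shows "cov_along \<Gamma> c (\<lambda>s. Y (c s)) t = cov \<Gamma> X Y (c t)"
proof -
  have "((Y \<circ> c) has_derivative
      (frechet_derivative Y (at (c t)) \<circ> (\<lambda>h. h *\<^sub>R vector_derivative c (at t)))) (at t)"
    using c Y vector_derivative_works[of c "at t"] frechet_derivative_works[of Y]
    by (intro diff_chain_at) (auto simp: has_vector_derivative_def)
  moreover have "linear (frechet_derivative Y (at (c t)))"
    by (rule linear_frechet_derivative[OF Y])
  ultimately have "((\<lambda>s. Y (c s)) has_vector_derivative
      frechet_derivative Y (at (c t)) (X (c t))) (at t)"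
    by (simp add: has_vector_derivative_def o_def X linear_scale)
  then show ?thesis
    by (simp add: cov_along_def cov_def vector_derivative_at X)
qed

lemma field_along_compose:
  assumes "bundle_curve I c" "tangent_field Y"
  shows "field_along I c (\<lambda>s. Y (c s))"
  using assms differentiable_chain_at[of c _ Y]
  by (auto simp: field_along_def bundle_curve_def tangent_field_def o_def)

section \<open>The Reeb flow and the length of generators along it\<close>

lemma reeb_flow_0: "reeb_flow p 0 = p"
  by (simp add: reeb_flow_def)

lemma reeb_flow_in_unit_bundle:
  assumes "(x, u) \<in> unit_bundle" and "mink u u = 1"
  shows "reeb_flow (x, u) s \<in> unit_bundle"
proof -
  have "mink x x = 1" "mink x u = 0" "mink u x = 0"
    using assms(1) by (auto simp: unit_bundle_iff mink_commute)
  then show ?thesis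
    using assms(2) sin_cos_squared_add3[of "2 * s"]
    by (simp add: reeb_flow_def unit_bundle_iff mink_linear algebra_simps)
qed

lemma reeb_flow_has_vector_derivative:
  "(reeb_flow p has_vector_derivative
     (2 *\<^sub>R snd (reeb_flow p s), - 2 *\<^sub>R fst (reeb_flow p s))) (at s)"
  unfolding reeb_flow_def
  by (rule has_vector_derivative_eq_rhs, rule has_vector_derivative_Pair)
    (auto intro!: derivative_eq_intros simp: algebra_simps)

lemma vector_derivative_reeb_flow_0:
  assumes "mink u u = 1"
  shows "vector_derivative (reeb_flow (x, u)) (at 0) = reeb (x, u)"
  using vector_derivative_at[OF reeb_flow_has_vector_derivative[of "(x, u)" 0]]
  by (simp add: reeb_flow_0 reeb_formula assms)

text \<open>\<open>A\<close> commutes with the rotation of the pair. The rotation preserves the sum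
  of the two squared norms, and the normal component \<open>mink y (A w)\<close>, being alternating
  in the pair, only picks up the determinant \<open>k * k + l * l = 1\<close>.\<close>

lemma g1_infinitesimal_action_reeb_flow:
  assumes A: "mink_skew A" and p: "(x, u) \<in> unit_bundle" and u: "mink u u = 1"
  shows "g1 (reeb_flow (x, u) s) (infinitesimal_action A (reeb_flow (x, u) s))
      (infinitesimal_action A (reeb_flow (x, u) s))
    = g1 (x, u) (infinitesimal_action A (x, u)) (infinitesimal_action A (x, u))"
proof -
  have skew: "mink y (A z) = - mink z (A y)" for y z
    using A mink_commute[of z "A y"] by (simp add: mink_skew_def)
  have null: "mink y (A y) = 0" for y
    using skew[of y y] by simp
  have lin: "A (r *\<^sub>R y) = r *\<^sub>R A y" "A (y + z) = A y + A z" "A (y - z) = A y - A z" for r y z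
    using A by (simp_all add: mink_skew_def linear_simps)
  define k l where "k = cos (2 * s)" and "l = sin (2 * s)"
  have kl: "k * k + l * l = 1"
    by (simp add: k_def l_def)
  define y w where "y = k *\<^sub>R x + l *\<^sub>R u" and "w = k *\<^sub>R u - l *\<^sub>R x"
  have yw: "reeb_flow (x, u) s = (y, w)"
    by (simp add: reeb_flow_def y_def w_def k_def l_def)
  have "mink y y = 1"
    using reeb_flow_in_unit_bundle[OF p u, of s] by (simp add: yw unit_bundle_iff)
  have "mink x x = 1"
    using p by (simp add: unit_bundle_iff)
  have "mink y (A w) = (k * k + l * l) * mink x (A u)"
    using skew[of u x]
    by (simp add: y_def w_def lin mink_linear null algebra_simps)
  moreover have "mink (A y) (A y) + mink (A w) (A w)
      = (k * k + l * l) * (mink (A x) (A x) + mink (A u) (A u))"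
    by (simp add: y_def w_def lin mink_linear mink_commute[of "A u" "A x"] algebra_simps)
  ultimately show ?thesis
    by (simp add: yw infinitesimal_action_def g1_formula \<open>mink y y = 1\<close> \<open>mink x x = 1\<close> kl)
qed

section \<open>The Killing property of the Reeb field and the theorem\<close>

lemma g1_commute: "g1 p V W = g1 p W V"
  by (simp add: g1_def sasaki_def mink_commute)

text \<open>Let \<open>V\<close> be the generator of \<open>A\<close>. Its bracket with
  \<open>reeb\<close> vanishes, so the derivative of \<open>reeb\<close> along \<open>V\<close>
  equals that of \<open>V\<close> along \<open>reeb\<close>; the product of the latter with
  \<open>V\<close> is half the derivative of the squared length of \<open>V\<close> along the flow,
  which is constant.\<close>

lemma reeb_killing:
  assumes \<Gamma>: "levi_civita \<Gamma>" and A: "mink_skew A"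
    and p: "(x, u) \<in> unit_bundle" and u: "mink u u = 1"
  shows "g1 (x, u) (cov \<Gamma> (infinitesimal_action A) reeb (x, u)) (infinitesimal_action A (x, u)) = 0"
proof -
  define V where "V = infinitesimal_action A"
  let ?c = "reeb_flow (x, u)"
  have V: "tangent_field V"
    unfolding V_def by (rule tangent_field_infinitesimal_action[OF A])
  have c: "bundle_curve UNIV ?c"
    by (simp add: bundle_curve_def reeb_flow_in_unit_bundle[OF p u]
        differentiableI_vector[OF reeb_flow_has_vector_derivative])
  have "cov \<Gamma> V reeb (x, u) - cov \<Gamma> reeb V (x, u) = lie_bracket V reeb (x, u)"
    using \<Gamma> V tangent_field_reeb p by (auto simp: levi_civita_def torsion_free_def)
  then have swap: "cov \<Gamma> V reeb (x, u) = cov \<Gamma> reeb V (x, u)"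
    unfolding V_def lie_bracket_infinitesimal_action_reeb[OF A] by simp
  have along: "cov_along \<Gamma> ?c (\<lambda>s. V (?c s)) 0 = cov \<Gamma> reeb V (?c 0)"
    using V p
    by (intro cov_along_compose differentiableI_vector[OF reeb_flow_has_vector_derivative])
      (auto simp: tangent_field_def reeb_flow_0 vector_derivative_reeb_flow_0[OF u])
  have "((\<lambda>s. g1 (?c s) (V (?c s)) (V (?c s))) has_real_derivative
      g1 (?c 0) (cov_along \<Gamma> ?c (\<lambda>s. V (?c s)) 0) (V (?c 0))
      + g1 (?c 0) (V (?c 0)) (cov_along \<Gamma> ?c (\<lambda>s. V (?c s)) 0)) (at 0)"
    using \<Gamma> c field_along_compose[OF c V] unfolding levi_civita_def metric_connection_def by blast
  then have "g1 (?c 0) (cov_along \<Gamma> ?c (\<lambda>s. V (?c s)) 0) (V (?c 0))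
      + g1 (?c 0) (V (?c 0)) (cov_along \<Gamma> ?c (\<lambda>s. V (?c s)) 0) = 0"
    by (rule derivative_of_constraint[where I = UNIV])
      (simp_all add: V_def g1_infinitesimal_action_reeb_flow[OF A p u])
  then show ?thesis
    unfolding along V_def[symmetric]
    by (simp add: reeb_flow_0 swap g1_commute[of "(x, u)" "V (x, u)"])
qed

theorem proposition3:
  fixes \<Gamma> :: "pt \<Rightarrow> pt \<Rightarrow> pt \<Rightarrow> pt"
    and I :: "real set"
    and \<gamma> X :: "real \<Rightarrow> real ^ 3"
    and c T N B :: "real \<Rightarrow> pt"
    and \<kappa> \<tau> :: "real \<Rightarrow> real"
    and \<epsilon>\<^sub>1 \<epsilon>\<^sub>2 \<epsilon>\<^sub>3 :: real
  assumes "levi_civita \<Gamma>"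
    and "open I" and "is_interval I" and "I \<noteq> {}"
    and "c = (\<lambda>t. (\<gamma> t, X t))"
    and "\<forall>t\<in>I. c t \<in> unit_bundle \<and> contact_metric_at (c t)"
    and "frenet_apparatus \<Gamma> I c T N B \<kappa> \<tau> \<epsilon>\<^sub>1 \<epsilon>\<^sub>2 \<epsilon>\<^sub>3"
    and "non_geodesic \<Gamma> I c T"
    and "legendre I c T \<or> slant I c T"
  shows "N_legendre I c N"
  unfolding N_legendre_def
proof
  fix t
  assume t: "t \<in> I"
  let ?\<xi> = "\<lambda>s. reeb (c s)"
  obtain x u where xu: "c t = (x, u)" by fastforce
  \<comment> \<open>The contact metric axioms select spacelike \<open>u\<close>, where the Reeb flow
    is a rotation.\<close>
  have p: "(x, u) \<in> unit_bundle" and u: "mink u u = 1"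
    using assms(6) t xu contact_metric_at_iff by (metis, metis)
  have c: "bundle_curve I c" and T: "field_along I c T"
    and T_eq: "T t = vector_derivative c (at t)" and TN: "cov_along \<Gamma> c T t = \<kappa> t *\<^sub>R N t"
    using assms(7) t by (auto simp: frenet_apparatus_def arc_length_curve_def)
  have "T t \<in> bundle_tangent (x, u)"
    using T t xu by (auto simp: field_along_def)
  \<comment> \<open>The generator depends on \<open>t\<close> and agrees with the velocity there,
    which suffices for a pointwise identity.\<close>
  then obtain A where A: "mink_skew A" "infinitesimal_action A (x, u) = T t"
    using infinitesimal_action_onto[OF p u] by blast
  have along: "cov_along \<Gamma> c ?\<xi> t = cov \<Gamma> (infinitesimal_action A) reeb (c t)"
    using c t tangent_field_reeb A T_eq xu
    by (intro cov_along_compose) (auto simp: bundle_curve_def tangent_field_def)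
  have "((\<lambda>s. g1 (c s) (T s) (?\<xi> s)) has_real_derivative
      g1 (c t) (cov_along \<Gamma> c T t) (?\<xi> t) + g1 (c t) (T t) (cov_along \<Gamma> c ?\<xi> t)) (at t)"
    using assms(1,2) c T t field_along_compose[OF c tangent_field_reeb]
    unfolding levi_civita_def metric_connection_def by blast
  \<comment> \<open>Legendre is the case \<open>k = 0\<close>; both cases enter only through
    constancy.\<close>
  moreover obtain k where "\<And>s. s \<in> I \<Longrightarrow> g1 (c s) (T s) (?\<xi> s) = k"
    using assms(9) by (auto simp: legendre_def slant_def)
  ultimately have "g1 (c t) (cov_along \<Gamma> c T t) (?\<xi> t) + g1 (c t) (T t) (cov_along \<Gamma> c ?\<xi> t) = 0"
    using assms(2) t derivative_of_constraint by blast
  moreover have "g1 (c t) (T t) (cov_along \<Gamma> c ?\<xi> t) = 0"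
    using reeb_killing[OF assms(1) A(1) p u] by (simp add: along xu A(2) g1_commute)
  ultimately have "\<kappa> t * g1 (c t) (N t) (?\<xi> t) = 0"
    by (simp add: TN g1_def sasaki_def hpart_def vpart_def deSitter_proj_def mink_linear
        algebra_simps)
  \<comment> \<open>\<open>non_geodesic\<close> holds at every parameter, so the curvature can be
    cancelled at this \<open>t\<close>.\<close>
  moreover have "\<kappa> t \<noteq> 0"
    using assms(8) t TN by (auto simp: non_geodesic_def)
  ultimately show "g1 (c t) (N t) (?\<xi> t) = 0"
    by simp
qed

end
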